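(* Let $1<p\le q\le r<\infty$ and let $a,b$ be weight functions on $\mathbb R^n$ with $a\in L^1(\mathbb R^n)$ and $b\in L^1(\mathbb R^n)$. Then the Hardy–Littlewood maximal operator $$M: W(L^r(\mathbb R^n),L^q(\mathbb R^n))\to W(L_a^{p)}(\mathbb R^n),L_b^{q)}(\mathbb R^n))$$ is bounded.
   Context: For a locally integrable $f$ on $\mathbb R^n$, the (centered) Hardy–Littlewood maximal function is $Mf(x)=\sup_{r>0}\frac1{|B_r(x)|}\int_{B_r(x)}|f(y)|\,dy$, where $B_r(x)$ is the open ball of radius $r$ centered at $x$. A weight function on $\mathbb R^n$ is a measurable, locally integrable real-valued function that is positive (it may vanish only on a set of measure zero). For $1<p<\infty$ and a weight $a$, the generalized grand Lebesgue space $L_a^{p)}(\mathbb R^n)$ consists of the (classes of) measurable $f$ with $$\|f\|_{L_a^{p)}(\mathbb R^n)}=\sup_{0<\varepsilon\le p-1}\varepsilon\left(\int_{\mathbb R^n}|f(x)|^{p-\varepsilon}a(x)^{\varepsilon/p}\,dx\right)^{1/(p-\varepsilon)}<\infty .$$ Fix a compact set $Q\subset\mathbb R^n$ with nonempty interior. For function spaces $B,C$ on $\mathbb R^n$ (classical Lebesgue or generalized grand Lebesgue spaces), the Wiener amalgam space $W(B,C)$ consists of all (classes of) measurable $f:\mathbb R^n\to\mathbb C$ such that $f\chi_K\in B$ for every compact $K\subset\mathbb R^n$ and such that $x\mapsto\|f\chi_{Q+x}\|_B$ belongs to $C$. Its norm is $\|f\|_{W(B,C)}=\big\|\,\|f\chi_{Q+x}\|_B\,\big\|_C$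 (outer norm in the variable $x$). Boundedness of $M:X\to Y$ means that there is $C>0$ with $Mf\in Y$ and $\|Mf\|_Y\le C\|f\|_X$ for all $f\in X$. *)

theory Defs
  imports "HOL-Analysis.Analysis"
begin

text \<open>
  A function space is given by the set of functions belonging to it together with its norm.
  Elements are represented by functions rather than by classes modulo equality almost everywhere;
  membership and norm are unaffected, in all spaces below, by changes on Lebesgue null sets. The value of the norm is
  meaningful only on members of the space.
\<close>

record 'a function_space =
  members :: "('a \<Rightarrow> complex) set"
  fnorm :: "('a \<Rightarrow> complex) \<Rightarrow> real"

definition lebesgue_space :: "real \<Rightarrow> 'a::euclidean_space function_space" where
  "lebesgue_space p =
    \<lparr>members = {f \<in> borel_measurable lebesgue. integrable lebesgue (\<lambda>x. norm (f x) powr p)},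
     fnorm = (\<lambda>f. (\<integral>x. norm (f x) powr p \<partial>lebesgue) powr (1 / p))\<rparr>"

definition weight :: "('a::euclidean_space \<Rightarrow> real) \<Rightarrow> bool" where
  "weight a \<longleftrightarrow>
    a \<in> borel_measurable lebesgue \<and>
    (\<forall>K. compact K \<longrightarrow> set_integrable lebesgue K a) \<and>
    (\<forall>x. 0 \<le> a x) \<and> (AE x in lebesgue. 0 < a x)"

definition grand_term ::
  "real \<Rightarrow> ('a::euclidean_space \<Rightarrow> real) \<Rightarrow> ('a \<Rightarrow> complex) \<Rightarrow> real \<Rightarrow> real" where
  "grand_term p a f \<epsilon> =
    \<epsilon> * (\<integral>x. norm (f x) powr (p - \<epsilon>) * a x powr (\<epsilon> / p) \<partial>lebesgue) powr (1 / (p - \<epsilon>))"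

text \<open>
  Integrability and boundedness together say that the supremum defining the norm, taken in the
  extended reals, is finite; without them the Bochner integral or the real supremum would be a
  default value.
\<close>

definition grand_lebesgue_space ::
  "real \<Rightarrow> ('a::euclidean_space \<Rightarrow> real) \<Rightarrow> 'a function_space" where
  "grand_lebesgue_space p a =
    \<lparr>members = {f \<in> borel_measurable lebesgue.
        (\<forall>\<epsilon>\<in>{0<..p - 1}.
           integrable lebesgue (\<lambda>x. norm (f x) powr (p - \<epsilon>) * a x powr (\<epsilon> / p))) \<and>
        bdd_above (grand_term p a f ` {0<..p - 1})},
     fnorm = (\<lambda>f. SUP \<epsilon>\<in>{0<..p - 1}. grand_term p a f \<epsilon>)\<rparr>"

definition restrict_to :: "'a set \<Rightarrow> ('a \<Rightarrow> complex) \<Rightarrow> 'a \<Rightarrow> complex" where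
  "restrict_to K f = (\<lambda>x. f x * indicator K x)"

definition local_norm ::
  "'a::euclidean_space set \<Rightarrow> 'a function_space \<Rightarrow> ('a \<Rightarrow> complex) \<Rightarrow> 'a \<Rightarrow> complex" where
  "local_norm Q B f = (\<lambda>x. complex_of_real (fnorm B (restrict_to ((+) x ` Q) f)))"

definition wiener_amalgam ::
  "'a::euclidean_space set \<Rightarrow> 'a function_space \<Rightarrow> 'a function_space \<Rightarrow> 'a function_space" where
  "wiener_amalgam Q B C =
    \<lparr>members = {f \<in> borel_measurable lebesgue.
        (\<forall>K. compact K \<longrightarrow> restrict_to K f \<in> members B) \<and> local_norm Q B f \<in> members C},
     fnorm = (\<lambda>f. fnorm C (local_norm Q B f))\<rparr>"

definition hl_maximal :: "('a::euclidean_space \<Rightarrow> complex) \<Rightarrow> 'a \<Rightarrow> ennreal" where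
  "hl_maximal f x =
    (SUP r\<in>{0<..}. (\<integral>\<^sup>+y\<in>ball x r. ennreal (norm (f y)) \<partial>lebesgue) / emeasure lebesgue (ball x r))"

text \<open>
  The maximal function may be infinite at some points. A function with values in the extended
  nonnegative reals counts as a member of a space of complex functions only if it is finite almost
  everywhere, and it is then identified with its finite part.
\<close>

definition finite_part :: "('a \<Rightarrow> ennreal) \<Rightarrow> 'a \<Rightarrow> complex" where
  "finite_part g = (\<lambda>x. complex_of_real (enn2real (g x)))"

definition bounded_operator ::
  "(('a::euclidean_space \<Rightarrow> complex) \<Rightarrow> 'a \<Rightarrow> ennreal) \<Rightarrow>
    'a function_space \<Rightarrow> 'a function_space \<Rightarrow> bool" where
  "bounded_operator T X Y \<longleftrightarrow>
    (\<exists>C>0. \<forall>f\<in>members X.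
       (AE x in lebesgue. T f x < \<infinity>) \<and>
       finite_part (T f) \<in> members Y \<and>
       fnorm Y (finite_part (T f)) \<le> C * fnorm X f)"

end

theory Submission
  imports Defs
begin

text \<open>
  Since \<open>p \<le> q \<le> r\<close>, everything passes through \<open>W(L\<^sup>q, L\<^sup>q)\<close>, which is \<open>L\<^sup>q\<close> by Tonelli.
  Hoelder's inequality on the translates of \<open>Q\<close> gives \<open>W(L\<^sup>r, L\<^sup>q) \<subseteq> L\<^sup>q\<close>, and the classical maximal
  theorem (weak type (1,1) from Vitali's covering lemma, then interpolation) keeps us in \<open>L\<^sup>q\<close>.
  Because \<open>a\<close> and \<open>b\<close> are integrable, Hoelder's inequality with exponents \<open>p / (p - \<epsilon>)\<close> and
  \<open>p / \<epsilon>\<close> bounds a grand Lebesgue norm by the ordinary Lebesgue norm of the same exponent, uniformly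
  in \<open>\<epsilon>\<close>; hence \<open>L\<^sup>q\<close> embeds into the target amalgam.
\<close>

subsection \<open>The maximal theorem\<close>

text \<open>The target norms are suprema over \<open>\<epsilon>\<close>, and this shapes the proof
  in two places. Uniformity: with \<open>\<theta> = (p - \<epsilon>) / p\<close> the integrand is
  \<open>(|f|^p)^\<theta> * a^(1 - \<theta>)\<close>, and after the root the integral of
  \<open>a\<close> carries the exponent \<open>\<epsilon> / (p * (p - \<epsilon>))\<close>. As
  \<open>\<epsilon> \<le> p - 1\<close> forces \<open>p - \<epsilon> \<ge> 1\<close>, this exponent
  lies in the unit interval, so 1 plus the integral of \<open>a\<close> serves for every
  \<open>\<epsilon>\<close>. Measurability: the outer norm needs the local norm to be measurable in
  the position of the window, and an uncountable supremum of measurable functions need not be.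

  The nonempty interior of \<open>Q\<close> enters through its positive measure: Tonelli controls
  only the measure of \<open>Q\<close> times the integral of \<open>|f|^q\<close>, and positivity is
  what makes that integral finite.\<close>

text \<open>
  Stated on the Borel measure, because Tonelli's theorem is not available for the completion.
\<close>

definition maximal :: "('a::euclidean_space \<Rightarrow> ennreal) \<Rightarrow> 'a \<Rightarrow> ennreal" where
  "maximal g x =
    (SUP r\<in>{0<..}. (\<integral>\<^sup>+y\<in>ball x r. g y \<partial>lborel) / emeasure lborel (ball x r))"

lemma emeasure_ball_pos: "0 < r \<Longrightarrow> 0 < emeasure lborel (ball (x::'a::euclidean_space) r)"
  by (simp add: emeasure_ball)

text \<open>Balls have positive finite measure, so the quotient can be cleared even in the extended
  reals. What remains is a witness radius, the form in which the maximal function is used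
  below.\<close>

lemma less_maximal_iff:
  "t < maximal g x \<longleftrightarrow>
    (\<exists>r>0. t * emeasure lborel (ball x r) < (\<integral>\<^sup>+y\<in>ball x r. g y \<partial>lborel))"
proof -
  have "t < u / emeasure lborel (ball x r) \<longleftrightarrow> t * emeasure lborel (ball x r) < u"
    if "0 < r" for r u
  proof -
    have "u / emeasure lborel (ball x r) \<le> t \<longleftrightarrow> u \<le> t * emeasure lborel (ball x r)"
    proof
      assume "u / emeasure lborel (ball x r) \<le> t"
      then have "u / emeasure lborel (ball x r) * emeasure lborel (ball x r)
          \<le> t * emeasure lborel (ball x r)"
        by (rule mult_right_mono) simp
      then show "u \<le> t * emeasure lborel (ball x r)"
        using emeasure_ball_pos[OF that, of x] emeasure_lborel_ball_finite[of x r]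
        by (simp add: ennreal_divide_times mult_divide_eq_ennreal)
    next
      assume "u \<le> t * emeasure lborel (ball x r)"
      then show "u / emeasure lborel (ball x r) \<le> t"
        using emeasure_ball_pos[OF that, of x]
        by (intro divide_le_posI_ennreal) (auto simp: mult.commute)
    qed
    then show ?thesis by (simp flip: not_le)
  qed
  then show ?thesis
    unfolding maximal_def less_SUP_iff by auto
qed

text \<open>Lower semicontinuity. A strict inequality at radius \<open>r\<close> survives when only
  the ball on the left grows to a slightly larger radius \<open>s\<close>, and
  \<open>ball y s\<close> contains \<open>ball x r\<close> for all \<open>y\<close> within
  \<open>s - r\<close> of \<open>x\<close>.\<close>

lemma open_less_maximal:
  fixes g :: "'a::euclidean_space \<Rightarrow> ennreal"
  shows "open {x. t < maximal g x}"
proof (subst open_subopen, intro ballI)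
  fix x assume "x \<in> {x. t < maximal g x}"
  then obtain r where r: "0 < r"
    and less: "t * emeasure lborel (ball x r) < (\<integral>\<^sup>+y\<in>ball x r. g y \<partial>lborel)" (is "_ < ?I")
    by (auto simp: less_maximal_iff)
  have "t < \<infinity>"
    using less emeasure_ball_pos[OF r, of x] by (auto simp: less_top[symmetric])
  then obtain u where u: "0 \<le> u" "t = ennreal u" by (cases t) auto
  let ?n = "DIM('a)"
  have eq: "t * emeasure lborel (ball y s) = ennreal (u * (unit_ball_vol ?n * s ^ ?n))"
    if "0 \<le> s" for s and y :: 'a
    using that u by (simp add: emeasure_ball ennreal_mult')
  have "((\<lambda>s. ennreal (u * (unit_ball_vol ?n * s ^ ?n))) \<longlongrightarrow>
      ennreal (u * (unit_ball_vol ?n * r ^ ?n))) (at_right r)"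
    by (intro tendsto_ennrealI tendsto_intros)
  then have "\<forall>\<^sub>F s in at_right r. ennreal (u * (unit_ball_vol ?n * s ^ ?n)) < ?I"
    by (rule order_tendstoD) (use less eq[of r x] r in simp)
  then obtain b where b: "b > r" "\<And>s. r < s \<Longrightarrow> s < b \<Longrightarrow> ennreal (u * (unit_ball_vol ?n * s ^ ?n)) < ?I"
    by (auto simp: eventually_at_right_field)
  define s where "s = (r + b) / 2"
  have s: "r < s" "s < b" using b by (auto simp: s_def)
  have "y \<in> {x. t < maximal g x}" if y: "y \<in> ball x (s - r)" for y
  proof -
    have "ball x r \<subseteq> ball y s"
      using y by (auto simp: dist_commute) (smt (verit) dist_triangle dist_commute)
    then have "?I \<le> (\<integral>\<^sup>+z\<in>ball y s. g z \<partial>lborel)"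
      by (intro nn_integral_mono) (auto split: split_indicator)
    then have "t * emeasure lborel (ball y s) < (\<integral>\<^sup>+z\<in>ball y s. g z \<partial>lborel)"
      using b(2)[OF s] eq[of s y] s r by simp
    then show ?thesis using s r by (auto simp: less_maximal_iff intro!: exI[of _ s])
  qed
  then show "\<exists>T. open T \<and> x \<in> T \<and> T \<subseteq> {x. t < maximal g x}"
    using s by (intro exI[of _ "ball x (s - r)"]) auto
qed

lemma borel_measurable_maximal [measurable]: "maximal g \<in> borel_measurable borel"
  by (rule borel_measurableI_greater) (simp add: open_less_maximal)

text \<open>Countable subadditivity with the sum written as an integral over
  \<open>count_space\<close>, so that the centres chosen by Vitali's lemma need no
  enumeration.\<close>

lemma emeasure_UN_le_nn_integral:
  assumes [measurable]: "\<And>i. i \<in> I \<Longrightarrow> X i \<in> sets M" and I: "countable I"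
  shows "emeasure M (\<Union>(X ` I)) \<le> (\<integral>\<^sup>+i. emeasure M (X i) \<partial>count_space I)"
proof -
  have [measurable]: "\<Union>(X ` I) \<in> sets M" using I by auto
  have "emeasure M (\<Union>(X ` I)) = (\<integral>\<^sup>+x. indicator (\<Union>(X ` I)) x \<partial>M)" by simp
  also have "\<dots> \<le> (\<integral>\<^sup>+x. \<integral>\<^sup>+i. indicator (X i) x \<partial>count_space I \<partial>M)"
  proof (rule nn_integral_mono)
    fix x
    show "indicator (\<Union>(X ` I)) x \<le> (\<integral>\<^sup>+i. indicator (X i) x \<partial>count_space I :: ennreal)"
    proof (cases "x \<in> \<Union>(X ` I)")
      case True
      then obtain i where i: "i \<in> I" "x \<in> X i" by auto
      have "(indicator (X i) x :: ennreal) \<le> (\<integral>\<^sup>+i. indicator (X i) x \<partial>count_space I)"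
        by (rule nn_integral_ge_point[OF i(1)])
      with i True show ?thesis by simp
    qed simp
  qed
  also have "\<dots> = (\<integral>\<^sup>+i. \<integral>\<^sup>+x. indicator (X i) x \<partial>M \<partial>count_space I)"
    by (rule nn_integral_count_space_nn_integral) (use I in auto)
  also have "\<dots> = (\<integral>\<^sup>+i. emeasure M (X i) \<partial>count_space I)"
    by (intro nn_integral_cong) auto
  finally show ?thesis .
qed

text \<open>Each point of the level set is the centre of a ball carrying \<open>g\<close>-mass more
  than \<open>t\<close> times its volume. Vitali selects disjoint ones whose fivefold enlargements
  still cover, whence the factor \<open>5 ^ DIM('a)\<close>.\<close>

lemma maximal_weak_type:
  fixes g :: "'a::euclidean_space \<Rightarrow> ennreal"
  assumes [measurable]: "g \<in> borel_measurable borel"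
  shows "t * emeasure lborel {x. t < maximal g x} \<le> 5 ^ DIM('a) * (\<integral>\<^sup>+x. g x \<partial>lborel)"
proof -
  let ?n = "DIM('a)" and ?E = "{x. t < maximal g x}"
  \<comment> \<open>For \<open>t = \<infinity>\<close> the level set is empty, and the product of
    infinity and 0 is 0.\<close>
  consider "t = 0 \<or> t = \<infinity>" | "(\<integral>\<^sup>+x. g x \<partial>lborel) = \<infinity>"
    | "0 < t" "t < \<infinity>" "(\<integral>\<^sup>+x. g x \<partial>lborel) < \<infinity>"
    by (metis less_top not_gr_zero infinity_ennreal_def)
  then show ?thesis
  proof cases
    case 1 then show ?thesis by auto
  next
    case 2 then show ?thesis by (simp add: ennreal_mult_top)
  next
    case 3
    then obtain u J where u: "0 < u" "t = ennreal u"
      and J: "0 \<le> J" "(\<integral>\<^sup>+x. g x \<partial>lborel) = ennreal J"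
      by (cases t; cases "\<integral>\<^sup>+x. g x \<partial>lborel") (auto simp: ennreal_zero_less_top)
    define \<rho> where "\<rho> x = (SOME r. 0 < r \<and>
      t * emeasure lborel (ball x r) < (\<integral>\<^sup>+y\<in>ball x r. g y \<partial>lborel))" for x
    have \<rho>: "0 < \<rho> x"
      "t * emeasure lborel (ball x (\<rho> x)) < (\<integral>\<^sup>+y\<in>ball x (\<rho> x). g y \<partial>lborel)"
      if "x \<in> ?E" for x
      using that someI_ex[of "\<lambda>r. 0 < r \<and>
        t * emeasure lborel (ball x r) < (\<integral>\<^sup>+y\<in>ball x r. g y \<partial>lborel)"]
      unfolding \<rho>_def by (auto simp: less_maximal_iff)
    \<comment> \<open>Vitali's lemma requires bounded radii. The mass condition bounds the volume of
      each ball by \<open>J / u\<close>, and a radius above 1 is at most its own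
      \<open>?n\<close>-th power.\<close>
    define B where "B = max 1 (J / (u * unit_ball_vol ?n))"
    have bounded: "\<rho> x \<le> B" if x: "x \<in> ?E" for x
    proof (cases "\<rho> x \<le> 1")
      case False
      have "t * emeasure lborel (ball x (\<rho> x)) \<le> (\<integral>\<^sup>+x. g x \<partial>lborel)"
        by (rule order_trans[OF less_imp_le[OF \<rho>(2)[OF x]]])
          (auto intro!: nn_integral_mono split: split_indicator)
      then have "u * (unit_ball_vol ?n * \<rho> x ^ ?n) \<le> J"
        using \<rho>(1)[OF x] u J by (simp add: emeasure_ball flip: ennreal_mult')
      moreover have "\<rho> x \<le> \<rho> x ^ ?n"
        using False by (intro self_le_power) auto
      ultimately have "u * (unit_ball_vol ?n * \<rho> x) \<le> J"
        using u by (smt (verit) mult_left_mono unit_ball_vol_nonneg of_nat_0_le_iff)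
      then have "\<rho> x \<le> J / (u * unit_ball_vol ?n)"
        using u by (simp add: field_simps)
      then show ?thesis by (simp add: B_def)
    qed (simp add: B_def)
    obtain C where C: "countable C" "C \<subseteq> ?E"
      "pairwise (\<lambda>i j. disjnt (cball i (\<rho> i)) (cball j (\<rho> j))) C"
      "?E \<subseteq> (\<Union>i\<in>C. cball i (5 * \<rho> i))"
    proof (rule Vitali_covering_lemma_cballs[where S = ?E and K = ?E and a = "\<lambda>x. x" and r = \<rho> and B = B])
      show "?E \<subseteq> (\<Union>i\<in>?E. cball i (\<rho> i))"
        using \<rho>(1) by (force simp: less_imp_le)
    qed (use \<rho> bounded in auto)
    have disj: "disjoint_family_on (\<lambda>i. ball i (\<rho> i)) C"
      unfolding disjoint_family_on_def
    proof (intro ballI impI)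
      fix i j assume "i \<in> C" "j \<in> C" "i \<noteq> j"
      then have "cball i (\<rho> i) \<inter> cball j (\<rho> j) = {}"
        using C(3) by (auto simp: pairwise_def disjnt_def)
      then show "ball i (\<rho> i) \<inter> ball j (\<rho> j) = {}"
        using ball_subset_cball by blast
    qed
    have "emeasure lborel ?E \<le> emeasure lborel (\<Union>i\<in>C. cball i (5 * \<rho> i))"
      using C by (intro emeasure_mono) auto
    also have "\<dots> \<le> (\<integral>\<^sup>+i. emeasure lborel (cball i (5 * \<rho> i)) \<partial>count_space C)"
      by (intro emeasure_UN_le_nn_integral) (use C in auto)
    also have "\<dots> = (\<integral>\<^sup>+i. 5 ^ ?n * emeasure lborel (ball i (\<rho> i)) \<partial>count_space C)"
    proof (rule nn_integral_cong)
      fix i assume "i \<in> space (count_space C)"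
      then have "0 < \<rho> i" using C \<rho> by auto
      then have "emeasure lborel (cball i (5 * \<rho> i)) =
          ennreal (5 ^ ?n * (unit_ball_vol ?n * \<rho> i ^ ?n))"
        by (simp add: emeasure_cball power_mult_distrib mult_ac)
      also have "\<dots> = 5 ^ ?n * emeasure lborel (ball i (\<rho> i))"
        using \<open>0 < \<rho> i\<close> by (subst ennreal_mult) (simp_all add: emeasure_ball flip: ennreal_power)
      finally show "emeasure lborel (cball i (5 * \<rho> i)) = 5 ^ ?n * emeasure lborel (ball i (\<rho> i))" .
    qed
    also have "\<dots> = 5 ^ ?n * (\<integral>\<^sup>+i. emeasure lborel (ball i (\<rho> i)) \<partial>count_space C)"
      by (rule nn_integral_cmult) simp
    finally have "t * emeasure lborel ?E \<le>
        5 ^ ?n * (t * (\<integral>\<^sup>+i. emeasure lborel (ball i (\<rho> i)) \<partial>count_space C))"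
      by (metis mult_left_mono zero_le mult.left_commute)
    also have "t * (\<integral>\<^sup>+i. emeasure lborel (ball i (\<rho> i)) \<partial>count_space C) =
        (\<integral>\<^sup>+i. t * emeasure lborel (ball i (\<rho> i)) \<partial>count_space C)"
      by (rule nn_integral_cmult[symmetric]) simp
    \<comment> \<open>With \<open>density lborel g\<close> in place of integrals over balls, summing
      over the disjoint balls is countable additivity of a measure.\<close>
    also have "\<dots> \<le> (\<integral>\<^sup>+i. emeasure (density lborel g) (ball i (\<rho> i)) \<partial>count_space C)"
      using C \<rho> by (intro nn_integral_mono) (auto simp: emeasure_density less_imp_le)
    also have "\<dots> = emeasure (density lborel g) (\<Union>i\<in>C. ball i (\<rho> i))"
      by (rule emeasure_UN_countable[symmetric]) (use C disj in auto)
    also have "\<dots> \<le> emeasure (density lborel g) UNIV"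
      by (intro emeasure_mono) auto
    also have "\<dots> = (\<integral>\<^sup>+x. g x \<partial>lborel)"
      by (simp add: emeasure_density)
    finally show ?thesis by (simp add: mult_left_mono)
  qed
qed

text \<open>Used with exponent \<open>q\<close> for the layer cake formula and with
  \<open>q - 1\<close> after the exchange of integrals. In the second case the integrand is
  unbounded near 0 if \<open>q < 2\<close>, yet integrable.\<close>

lemma nn_integral_powr_Ioo:
  fixes \<alpha> c :: real
  assumes "0 < \<alpha>" "0 \<le> c"
  shows "(\<integral>\<^sup>+t. (if 0 < t \<and> t < c then ennreal (\<alpha> * t powr (\<alpha> - 1)) else 0) \<partial>lborel) = ennreal (c powr \<alpha>)"
proof -
  have "((\<lambda>t. \<alpha> * t powr (\<alpha> - 1)) has_integral \<alpha> * (c powr (\<alpha> - 1 + 1) / (\<alpha> - 1 + 1))) {0..c}"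
    by (intro has_integral_mult_right has_integral_powr_from_0) (use assms in auto)
  then have "((\<lambda>t. \<alpha> * t powr (\<alpha> - 1)) has_integral c powr \<alpha>) {0<..<c}"
    using assms by (simp add: has_integral_Icc_iff_Ioo)
  then have "(\<integral>\<^sup>+t. indicator {0<..<c} t * (\<alpha> * t powr (\<alpha> - 1)) \<partial>lborel) = ennreal (c powr \<alpha>)"
    by (intro nn_integral_has_integral_lebesgue) (use assms in auto)
  then show ?thesis
    by (elim trans[rotated]) (intro nn_integral_cong, auto simp: indicator_def)
qed

text \<open>The truncation behind Marcinkiewicz interpolation: values of \<open>g\<close> up to
  \<open>t / 2\<close> add at most \<open>t / 2\<close> to any average, so the large values alone
  must produce an average above \<open>t / 2\<close>. The weak type bound is then applied to
  them.\<close>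

lemma maximal_level_set:
  fixes g :: "'a::euclidean_space \<Rightarrow> ennreal"
  assumes [measurable]: "g \<in> borel_measurable borel" and t: "0 < t"
  shows "ennreal t * emeasure lborel {x. ennreal t < maximal g x} \<le>
    2 * 5 ^ DIM('a) * (\<integral>\<^sup>+y. (if ennreal (t / 2) < g y then g y else 0) \<partial>lborel)"
proof -
  let ?h = "\<lambda>y. if ennreal (t / 2) < g y then g y else 0"
  have t2: "ennreal t = ennreal (t / 2) + ennreal (t / 2)"
    using t by (simp flip: ennreal_plus)
  have "{x. ennreal t < maximal g x} \<subseteq> {x. ennreal (t / 2) < maximal ?h x}"
  proof safe
    fix x assume "ennreal t < maximal g x"
    then obtain r where r: "0 < r"
      and less: "ennreal t * emeasure lborel (ball x r) < (\<integral>\<^sup>+y\<in>ball x r. g y \<partial>lborel)"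
      by (auto simp: less_maximal_iff)
    let ?b = "ennreal (t / 2) * emeasure lborel (ball x r)"
    note less
    also have "(\<integral>\<^sup>+y\<in>ball x r. g y \<partial>lborel) \<le>
        (\<integral>\<^sup>+y. ?h y * indicator (ball x r) y + ennreal (t / 2) * indicator (ball x r) y \<partial>lborel)"
      by (intro nn_integral_mono) (auto split: split_indicator simp: not_less)
    also have "\<dots> = (\<integral>\<^sup>+y\<in>ball x r. ?h y \<partial>lborel) + ?b"
    proof -
      have "(\<integral>\<^sup>+y. ennreal (t / 2) * indicator (ball x r) y \<partial>lborel) = ?b"
        by (rule nn_integral_cmult_indicator) simp
      moreover have "(\<lambda>y. ?h y * indicator (ball x r) y) \<in> borel_measurable lborel"
        "(\<lambda>y. ennreal (t / 2) * indicator (ball x r) y) \<in> borel_measurable lborel"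
        by (intro borel_measurable_times_ennreal borel_measurable_indicator; measurable; simp)+
      ultimately show ?thesis by (subst nn_integral_add) simp_all
    qed
    finally have "?b + ?b < (\<integral>\<^sup>+y\<in>ball x r. ?h y \<partial>lborel) + ?b"
      by (simp add: t2 distrib_right)
    \<comment> \<open>Cancellation by contraposing monotonicity of addition, which is sound for
      infinite values too.\<close>
    then have "?b < (\<integral>\<^sup>+y\<in>ball x r. ?h y \<partial>lborel)"
      by (meson add_right_mono not_le)
    then show "ennreal (t / 2) < maximal ?h x"
      using r by (auto simp: less_maximal_iff)
  qed
  then have "emeasure lborel {x. ennreal t < maximal g x} \<le>
      emeasure lborel {x. ennreal (t / 2) < maximal ?h x}"
    by (intro emeasure_mono) auto
  then have "ennreal t * emeasure lborel {x. ennreal t < maximal g x} \<le>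
      2 * (ennreal (t / 2) * emeasure lborel {x. ennreal (t / 2) < maximal ?h x})"
    by (simp add: t2 mult_2 distrib_right mult_left_mono add_mono)
  also have "\<dots> \<le> 2 * (5 ^ DIM('a) * (\<integral>\<^sup>+y. ?h y \<partial>lborel))"
    by (intro mult_left_mono maximal_weak_type) auto
  finally show ?thesis by (simp add: mult.assoc)
qed

text \<open>The factor \<open>2 * 5 ^ DIM('a)\<close> is that of \<open>maximal_level_set\<close>;
  the rest comes from integrating \<open>q * t powr (q - 2)\<close> over
  \<open>0 < t < 2 * g y\<close>, where the 2 reflects the truncation at
  \<open>t / 2\<close>.\<close>

definition maximal_const :: "'a::euclidean_space itself \<Rightarrow> real \<Rightarrow> real" where
  "maximal_const T q = 2 * 5 ^ DIM('a) * (q / (q - 1)) * 2 powr (q - 1)"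

text \<open>Write the \<open>q\<close>-th power as an integral over levels \<open>t\<close>,
  exchange integrals, bound each level set by the truncated weak type estimate, and exchange back:
  for fixed \<open>y\<close> only levels below \<open>2 * g y\<close> contribute.\<close>

theorem maximal_strong_type:
  fixes g :: "'a::euclidean_space \<Rightarrow> real"
  assumes [measurable]: "g \<in> borel_measurable borel" and g0: "\<And>x. 0 \<le> g x" and q: "1 < q"
    and fin: "(\<integral>\<^sup>+x. ennreal (g x powr q) \<partial>lborel) < \<infinity>"
  shows "AE x in lborel. maximal g x < \<infinity>"
    and "(\<integral>\<^sup>+x. ennreal (enn2real (maximal g x) powr q) \<partial>lborel) \<le>
      ennreal (maximal_const TYPE('a) q) * (\<integral>\<^sup>+x. ennreal (g x powr q) \<partial>lborel)"
proof -
  \<comment> \<open>Layer cake: \<open>\<Phi> m\<close> is the \<open>q\<close>-th power of \<open>m\<close>, also for \<open>m = \<infinity>\<close>.\<close>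
  define \<Phi> where "\<Phi> m =
    (\<integral>\<^sup>+t. (if 0 < t \<and> ennreal t < m then ennreal (q * t powr (q - 1)) else 0) \<partial>lborel)" for m
  let ?n = "DIM('a)"
  have \<Phi>_ennreal: "\<Phi> (ennreal c) = ennreal (c powr q)" if "0 \<le> c" for c
    unfolding \<Phi>_def using q that
    by (subst nn_integral_powr_Ioo[of q c, symmetric])
      (auto intro!: nn_integral_cong simp: ennreal_less_iff)
  have \<Phi>_mono: "\<Phi> m \<le> \<Phi> m'" if "m \<le> m'" for m m'
    unfolding \<Phi>_def using that by (intro nn_integral_mono) (auto dest: less_le_trans)
  \<comment> \<open>\<open>\<Phi> \<infinity>\<close> dominates \<open>c powr q\<close> for every
    finite \<open>c\<close>, so no bound \<open>B\<close> is possible.\<close>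
  have \<Phi>_top: "\<Phi> \<infinity> = \<infinity>"
  proof (rule ccontr)
    assume "\<Phi> \<infinity> \<noteq> \<infinity>"
    then obtain B where B: "0 \<le> B" "\<Phi> \<infinity> = ennreal B" by (cases "\<Phi> \<infinity>") auto
    define c where "c = (B + 1) powr (1 / q)"
    have "ennreal (c powr q) \<le> ennreal B"
      using \<Phi>_mono[of "ennreal c" \<infinity>] \<Phi>_ennreal[of c] B by (simp add: c_def)
    moreover have "c powr q = B + 1"
      using B q by (simp add: c_def powr_powr)
    ultimately show False using B by (simp add: ennreal_le_iff)
  qed
  \<comment> \<open>One factor \<open>t\<close> is split off to meet the measure of the level set in
    \<open>maximal_level_set\<close>.\<close>
  have eq: "ennreal (q * t powr (q - 1)) = ennreal (q * t powr (q - 2)) * ennreal t" if "0 < t" for t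
  proof -
    have "t powr (q - 1) = t powr (q - 2) * t"
      using that powr_mult_base[of t "q - 2"] by (simp add: mult.commute algebra_simps)
    then show ?thesis using that q by (simp flip: ennreal_mult')
  qed
  have [measurable]: "\<Phi> \<in> borel_measurable borel"
    unfolding \<Phi>_def by measurable
  have "(\<integral>\<^sup>+x. \<Phi> (maximal g x) \<partial>lborel) =
      (\<integral>\<^sup>+t. \<integral>\<^sup>+x. (if 0 < t \<and> ennreal t < maximal g x then ennreal (q * t powr (q - 1)) else 0)
        \<partial>lborel \<partial>lborel)"
    unfolding \<Phi>_def by (rule lborel_pair.Fubini'[symmetric]) measurable
  also have "\<dots> \<le> (\<integral>\<^sup>+t. \<integral>\<^sup>+y. (if 0 < t \<and> t < 2 * g y
      then ennreal (2 * 5 ^ ?n * q * g y * t powr (q - 2)) else 0) \<partial>lborel \<partial>lborel)"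
  proof (rule nn_integral_mono)
    fix t :: real
    show "(\<integral>\<^sup>+x. (if 0 < t \<and> ennreal t < maximal g x then ennreal (q * t powr (q - 1)) else 0) \<partial>lborel)
      \<le> (\<integral>\<^sup>+y. (if 0 < t \<and> t < 2 * g y
        then ennreal (2 * 5 ^ ?n * q * g y * t powr (q - 2)) else 0) \<partial>lborel)"
    proof (cases "0 < t")
      case True
      have "(\<integral>\<^sup>+x. (if 0 < t \<and> ennreal t < maximal g x then ennreal (q * t powr (q - 1)) else 0) \<partial>lborel)
        = (\<integral>\<^sup>+x. ennreal (q * t powr (q - 1)) * indicator {x. ennreal t < maximal g x} x \<partial>lborel)"
        using True by (intro nn_integral_cong) (auto split: split_indicator)
      also have "\<dots> = ennreal (q * t powr (q - 1)) * emeasure lborel {x. ennreal t < maximal g x}"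
        by (rule nn_integral_cmult_indicator) simp
      also have "\<dots> = ennreal (q * t powr (q - 2)) *
          (ennreal t * emeasure lborel {x. ennreal t < maximal g x})"
        using eq[OF True] by (simp add: mult.assoc)
      also have "\<dots> \<le> ennreal (q * t powr (q - 2)) * (2 * 5 ^ ?n *
          (\<integral>\<^sup>+y. (if ennreal (t / 2) < ennreal (g y) then ennreal (g y) else 0) \<partial>lborel))"
        using True by (intro mult_left_mono maximal_level_set) auto
      also have "\<dots> = (\<integral>\<^sup>+y. ennreal (q * t powr (q - 2)) * (2 * 5 ^ ?n) *
          (if ennreal (t / 2) < ennreal (g y) then ennreal (g y) else 0) \<partial>lborel)"
        by (subst nn_integral_cmult) (auto simp: mult.assoc)
      also have "\<dots> = (\<integral>\<^sup>+y. (if 0 < t \<and> t < 2 * g y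
        then ennreal (2 * 5 ^ ?n * q * g y * t powr (q - 2)) else 0) \<partial>lborel)"
      proof (rule nn_integral_cong)
        fix y
        have c: "(2 * 5 ^ ?n :: ennreal) = ennreal (2 * 5 ^ ?n)"
          by (simp add: ennreal_mult flip: ennreal_power)
        have "ennreal (q * t powr (q - 2)) * (2 * 5 ^ ?n) * ennreal (g y) =
            ennreal (2 * 5 ^ ?n * q * g y * t powr (q - 2))"
          unfolding c using q g0[of y] by (simp add: ac_simps flip: ennreal_mult)
        then show "ennreal (q * t powr (q - 2)) * (2 * 5 ^ ?n) *
          (if ennreal (t / 2) < ennreal (g y) then ennreal (g y) else 0) =
          (if 0 < t \<and> t < 2 * g y then ennreal (2 * 5 ^ ?n * q * g y * t powr (q - 2)) else 0)"
          using True g0[of y] by (auto simp: ennreal_less_iff)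
      qed
      finally show ?thesis .
    qed simp
  qed
  also have "\<dots> = (\<integral>\<^sup>+y. \<integral>\<^sup>+t. (if 0 < t \<and> t < 2 * g y
      then ennreal (2 * 5 ^ ?n * q * g y * t powr (q - 2)) else 0) \<partial>lborel \<partial>lborel)"
    by (rule lborel_pair.Fubini') measurable
  also have "\<dots> = (\<integral>\<^sup>+y. ennreal (maximal_const TYPE('a) q) * ennreal (g y powr q) \<partial>lborel)"
  proof (rule nn_integral_cong)
    fix y
    \<comment> \<open>Writing \<open>q\<close> as \<open>q / (q - 1) * (q - 1)\<close> makes the
      integrand the derivative of \<open>t powr (q - 1)\<close>.\<close>
    let ?c = "2 * 5 ^ ?n * (q / (q - 1)) * g y"
    have c: "0 \<le> ?c" using q g0[of y] by simp
    have "(\<integral>\<^sup>+t. (if 0 < t \<and> t < 2 * g y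
        then ennreal (2 * 5 ^ ?n * q * g y * t powr (q - 2)) else 0) \<partial>lborel) =
      (\<integral>\<^sup>+t. ennreal ?c * (if 0 < t \<and> t < 2 * g y
        then ennreal ((q - 1) * t powr (q - 1 - 1)) else 0) \<partial>lborel)"
      using q c by (intro nn_integral_cong) (auto simp flip: ennreal_mult')
    also have "\<dots> = ennreal ?c * ennreal ((2 * g y) powr (q - 1))"
      using q g0[of y] by (subst nn_integral_cmult) (auto simp: nn_integral_powr_Ioo)
    also have "\<dots> = ennreal (maximal_const TYPE('a) q) * ennreal (g y powr q)"
    proof -
      have "g y * g y powr (q - 1) = g y powr q"
        using powr_mult_base[OF g0, of y "q - 1"] by simp
      then have "?c * (2 * g y) powr (q - 1) = maximal_const TYPE('a) q * g y powr q"
        using g0[of y] by (simp add: maximal_const_def powr_mult)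
      moreover have "0 \<le> maximal_const TYPE('a) q"
        using q by (simp add: maximal_const_def)
      ultimately show ?thesis
        using c by (metis ennreal_mult powr_ge_zero)
    qed
    finally show "(\<integral>\<^sup>+t. (if 0 < t \<and> t < 2 * g y
        then ennreal (2 * 5 ^ ?n * q * g y * t powr (q - 2)) else 0) \<partial>lborel) =
      ennreal (maximal_const TYPE('a) q) * ennreal (g y powr q)" .
  qed
  also have "\<dots> = ennreal (maximal_const TYPE('a) q) * (\<integral>\<^sup>+x. ennreal (g x powr q) \<partial>lborel)"
    by (rule nn_integral_cmult) simp
  finally have main: "(\<integral>\<^sup>+x. \<Phi> (maximal g x) \<partial>lborel) \<le>
    ennreal (maximal_const TYPE('a) q) * (\<integral>\<^sup>+x. ennreal (g x powr q) \<partial>lborel)" .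
  also have "\<dots> < \<infinity>" using fin by (simp add: ennreal_mult_less_top)
  finally have "AE x in lborel. \<Phi> (maximal g x) \<noteq> \<infinity>"
    by (intro nn_integral_PInf_AE) auto
  then show "AE x in lborel. maximal g x < \<infinity>"
    by eventually_elim (metis \<Phi>_top less_top infinity_ennreal_def)
  have "(\<integral>\<^sup>+x. ennreal (enn2real (maximal g x) powr q) \<partial>lborel) \<le> (\<integral>\<^sup>+x. \<Phi> (maximal g x) \<partial>lborel)"
  proof (rule nn_integral_mono)
    fix x
    \<comment> \<open>At an infinite value \<open>enn2real\<close> returns 0, so the inequality
      holds there as well.\<close>
    show "ennreal (enn2real (maximal g x) powr q) \<le> \<Phi> (maximal g x)"
      using \<Phi>_top by (cases "maximal g x") (auto simp: \<Phi>_ennreal)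
  qed
  with main show "(\<integral>\<^sup>+x. ennreal (enn2real (maximal g x) powr q) \<partial>lborel) \<le>
      ennreal (maximal_const TYPE('a) q) * (\<integral>\<^sup>+x. ennreal (g x powr q) \<partial>lborel)"
    by (rule order_trans[rotated])
qed

subsection \<open>Hoelder's inequality and the grand Lebesgue norm\<close>

text \<open>A crude bound whose right-hand side is free of the exponent; it removes
  \<open>\<epsilon>\<close> from the constants.\<close>

lemma powr_le_one_plus:
  fixes A s :: real
  assumes "0 \<le> A" "0 \<le> s" "s \<le> 1"
  shows "A powr s \<le> 1 + A"
proof -
  have "A powr s \<le> (1 + A) powr s"
    using assms by (intro powr_mono2) auto
  also have "\<dots> \<le> (1 + A) powr 1"
    using assms by (intro powr_mono) auto
  finally show ?thesis using assms by simp
qed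

text \<open>Young's inequality in weighted form. It yields Hoelder's inequality and also the
  integrable majorant for continuity in \<open>\<epsilon>\<close>.\<close>

lemma powr_mult_powr_le:
  fixes u v \<theta> :: real
  assumes "0 \<le> u" "0 \<le> v" "0 < \<theta>" "\<theta> < 1"
  shows "u powr \<theta> * v powr (1 - \<theta>) \<le> \<theta> * u + (1 - \<theta>) * v"
proof (cases "u = 0 \<or> v = 0")
  case False
  then show ?thesis
    using Youngs_inequality_0[of \<theta> "1 - \<theta>" u v] assms by auto
qed (use assms in auto)

lemma Hoelder_powr:
  fixes u v :: "'a \<Rightarrow> real"
  assumes u: "integrable M u" "\<And>x. 0 \<le> u x" and v: "integrable M v" "\<And>x. 0 \<le> v x"
    and \<theta>: "0 < \<theta>" "\<theta> < 1"
  shows "integrable M (\<lambda>x. u x powr \<theta> * v x powr (1 - \<theta>))"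
    and "(\<integral>x. u x powr \<theta> * v x powr (1 - \<theta>) \<partial>M) \<le>
      (\<integral>x. u x \<partial>M) powr \<theta> * (\<integral>x. v x \<partial>M) powr (1 - \<theta>)"
proof -
  have [measurable]: "u \<in> borel_measurable M" "v \<in> borel_measurable M"
    using u v by auto
  let ?w = "\<lambda>x. u x powr \<theta> * v x powr (1 - \<theta>)"
  let ?U = "\<integral>x. u x \<partial>M" and ?V = "\<integral>x. v x \<partial>M"
  show int: "integrable M ?w"
  proof (rule Bochner_Integration.integrable_bound)
    show "integrable M (\<lambda>x. \<theta> * u x + (1 - \<theta>) * v x)"
      using u v by auto
    show "AE x in M. norm (?w x) \<le> norm (\<theta> * u x + (1 - \<theta>) * v x)"
    proof (rule AE_I2)
      fix x
      show "norm (?w x) \<le> norm (\<theta> * u x + (1 - \<theta>) * v x)"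
        using powr_mult_powr_le[OF u(2) v(2) \<theta>, of x x] u(2)[of x] v(2)[of x] \<theta> by simp
    qed
  qed measurable
  show "(\<integral>x. ?w x \<partial>M) \<le> ?U powr \<theta> * ?V powr (1 - \<theta>)"
  \<comment> \<open>Normalising by the two integrals needs both to be positive; if one vanishes, so
    does the product almost everywhere.\<close>
  proof (cases "?U = 0 \<or> ?V = 0")
    case True
    then have "AE x in M. u x = 0 \<or> v x = 0"
    proof
      assume "?U = 0"
      then have "AE x in M. u x = 0" using u by (simp add: integral_nonneg_eq_0_iff_AE)
      then show ?thesis by eventually_elim simp
    next
      assume "?V = 0"
      then have "AE x in M. v x = 0" using v by (simp add: integral_nonneg_eq_0_iff_AE)
      then show ?thesis by eventually_elim simp
    qed
    then have "AE x in M. ?w x = 0" by eventually_elim auto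
    then have "(\<integral>x. ?w x \<partial>M) = 0" by (rule integral_eq_zero_AE)
    then show ?thesis by simp
  next
    case False
    then have U: "0 < ?U" and V: "0 < ?V"
      using u v by (auto simp: less_le)
    have "(\<integral>x. ?w x \<partial>M) / (?U powr \<theta> * ?V powr (1 - \<theta>)) =
        (\<integral>x. (u x / ?U) powr \<theta> * (v x / ?V) powr (1 - \<theta>) \<partial>M)"
      using U V u v by (simp add: powr_divide)
    also have "\<dots> \<le> (\<integral>x. \<theta> * (u x / ?U) + (1 - \<theta>) * (v x / ?V) \<partial>M)"
    proof (rule integral_mono)
      show "integrable M (\<lambda>x. (u x / ?U) powr \<theta> * (v x / ?V) powr (1 - \<theta>))"
        using int U V u v by (simp add: powr_divide)
      show "integrable M (\<lambda>x. \<theta> * (u x / ?U) + (1 - \<theta>) * (v x / ?V))"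
        using u v by auto
      show "(u x / ?U) powr \<theta> * (v x / ?V) powr (1 - \<theta>) \<le> \<theta> * (u x / ?U) + (1 - \<theta>) * (v x / ?V)" for x
        using U V u(2)[of x] v(2)[of x] \<theta> by (intro powr_mult_powr_le) auto
    qed
    also have "\<dots> = 1"
      using u v U V by simp
    finally show ?thesis
      using U V by (simp add: divide_le_eq)
  qed
qed

text \<open>Hoelder's inequality against the indicator of \<open>S\<close>, with the resulting power
  of its measure replaced by \<open>1 + measure M S\<close>.\<close>

lemma powr_norm_mono_finite_support:
  fixes h :: "'a \<Rightarrow> real"
  assumes h: "h \<in> borel_measurable M" "\<And>x. 0 \<le> h x" "\<And>x. x \<notin> S \<Longrightarrow> h x = 0"
    and S: "S \<in> sets M" "emeasure M S < \<infinity>"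
    and st: "0 < s" "s \<le> t" and int: "integrable M (\<lambda>x. h x powr t)"
  shows "integrable M (\<lambda>x. h x powr s)"
    and "(\<integral>x. h x powr s \<partial>M) \<le> (1 + measure M S) * (\<integral>x. h x powr t \<partial>M) powr (s / t)"
proof -
  have "integrable M (\<lambda>x. h x powr s) \<and>
    (\<integral>x. h x powr s \<partial>M) \<le> (1 + measure M S) * (\<integral>x. h x powr t \<partial>M) powr (s / t)"
  \<comment> \<open>Equality would give \<open>\<theta> = 1\<close>, which
    \<open>Hoelder_powr\<close> excludes.\<close>
  proof (cases "s = t")
    case True
    have "(\<integral>x. h x powr t \<partial>M) \<le> (1 + measure M S) * (\<integral>x. h x powr t \<partial>M)"
      by (simp add: distrib_right)
    then show ?thesis using True st int by simp
  next
    case False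
    define \<theta> where "\<theta> = s / t"
    have \<theta>: "0 < \<theta>" "\<theta> < 1" using st False by (auto simp: \<theta>_def)
    \<comment> \<open>Off \<open>S\<close> both sides are 0, because \<open>h\<close> vanishes there
      and \<open>0 powr s = 0\<close>.\<close>
    have eq: "h x powr s = (h x powr t) powr \<theta> * indicat_real S x powr (1 - \<theta>)" for x
      using h(3)[of x] st \<theta> by (auto simp: powr_powr \<theta>_def indicator_def)
    have ind: "integrable M (indicat_real S)"
      using S by (simp add: integrable_indicator_iff)
    have "(\<integral>x. h x powr s \<partial>M) \<le> (\<integral>x. h x powr t \<partial>M) powr \<theta> * measure M S powr (1 - \<theta>)"
      using Hoelder_powr(2)[OF int _ ind _ \<theta>] S by (simp add: eq sets.Int_space_eq2)
    also have "\<dots> \<le> (\<integral>x. h x powr t \<partial>M) powr \<theta> * (1 + measure M S)"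
      using \<theta> by (intro mult_left_mono powr_le_one_plus) auto
    finally show ?thesis
      using Hoelder_powr(1)[OF int _ ind _ \<theta>] by (simp add: eq \<theta>_def mult.commute)
  qed
  then show "integrable M (\<lambda>x. h x powr s)"
    and "(\<integral>x. h x powr s \<partial>M) \<le> (1 + measure M S) * (\<integral>x. h x powr t \<partial>M) powr (s / t)"
    by auto
qed

section \<open>Grand Lebesgue norm of an \<open>L^p\<close> function with integrable weight\<close>

context
  fixes p :: real and a :: "'a::euclidean_space \<Rightarrow> real" and f :: "'a \<Rightarrow> complex"
  assumes p: "1 < p"
    and a: "integrable lebesgue a" "\<And>x. 0 \<le> a x"
    and f [measurable]: "f \<in> borel_measurable lebesgue"
    and fp: "integrable lebesgue (\<lambda>x. norm (f x) powr p)"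
begin

lemma grand_term_nonneg: "0 < \<epsilon> \<Longrightarrow> 0 \<le> grand_term p a f \<epsilon>"
  by (simp add: grand_term_def)

lemma integrable_grand_term:
  assumes \<epsilon>: "0 < \<epsilon>" "\<epsilon> \<le> p - 1"
  shows "integrable lebesgue (\<lambda>x. norm (f x) powr (p - \<epsilon>) * a x powr (\<epsilon> / p))" (is "integrable _ ?w")
    and "grand_term p a f \<epsilon> \<le>
      (p - 1) * (1 + (\<integral>x. a x \<partial>lebesgue)) * (\<integral>x. norm (f x) powr p \<partial>lebesgue) powr (1 / p)"
proof -
  let ?A = "\<integral>x. a x \<partial>lebesgue" and ?F = "\<integral>x. norm (f x) powr p \<partial>lebesgue"
  define \<theta> where "\<theta> = (p - \<epsilon>) / p"
  have \<theta>: "0 < \<theta>" "\<theta> < 1" and \<theta>': "1 - \<theta> = \<epsilon> / p" "p * \<theta> = p - \<epsilon>"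
    using p \<epsilon> by (auto simp: \<theta>_def field_simps)
  have eq: "?w = (\<lambda>x. (norm (f x) powr p) powr \<theta> * a x powr (1 - \<theta>))"
    by (simp add: \<theta>' powr_powr)
  show "integrable lebesgue ?w"
    unfolding eq by (rule Hoelder_powr(1)) (use fp a \<theta> in auto)
  have A: "0 \<le> ?A" using a by simp
  have "(\<integral>x. ?w x \<partial>lebesgue) \<le> ?F powr \<theta> * ?A powr (1 - \<theta>)"
    unfolding eq by (rule Hoelder_powr(2)) (use fp a \<theta> in auto)
  then have "(\<integral>x. ?w x \<partial>lebesgue) powr (1 / (p - \<epsilon>)) \<le>
      (?F powr \<theta> * ?A powr (1 - \<theta>)) powr (1 / (p - \<epsilon>))"
    using \<epsilon> by (intro powr_mono2) auto
  also have "\<dots> = ?F powr (1 / p) * ?A powr (\<epsilon> / p / (p - \<epsilon>))"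
  proof -
    have "\<theta> * (1 / (p - \<epsilon>)) = 1 / p" using \<epsilon> p by (simp add: \<theta>_def)
    then show ?thesis by (simp add: powr_mult powr_powr \<theta>'(1) del: times_divide_eq_right) (simp add: mult.commute)
  qed
  also have "\<dots> \<le> ?F powr (1 / p) * (1 + ?A)"
  proof (intro mult_left_mono powr_le_one_plus A)
    \<comment> \<open>The left side is below 1 and \<open>p - \<epsilon>\<close> is at least
      1.\<close>
    have "\<epsilon> / p \<le> 1 * (p - \<epsilon>)"
      using \<epsilon> p by (smt (verit) divide_le_eq_1)
    then show "\<epsilon> / p / (p - \<epsilon>) \<le> 1"
      using \<epsilon> by (subst divide_le_eq) auto
  qed (use \<epsilon> p in auto)
  finally have "grand_term p a f \<epsilon> \<le> (p - 1) * (?F powr (1 / p) * (1 + ?A))"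
    unfolding grand_term_def using \<epsilon> by (intro mult_mono) auto
  then show "grand_term p a f \<epsilon> \<le> (p - 1) * (1 + ?A) * ?F powr (1 / p)"
    by (simp add: ac_simps)
qed

lemma bdd_above_grand_term: "bdd_above (grand_term p a f ` {0<..p - 1})"
  by (rule bdd_aboveI2) (rule integrable_grand_term(2), auto)

lemma members_grand_lebesgue_space: "f \<in> members (grand_lebesgue_space p a)"
  using integrable_grand_term(1) bdd_above_grand_term by (auto simp: grand_lebesgue_space_def)

lemma fnorm_grand_lebesgue_space_le:
  "fnorm (grand_lebesgue_space p a) f \<le>
    (p - 1) * (1 + (\<integral>x. a x \<partial>lebesgue)) * (\<integral>x. norm (f x) powr p \<partial>lebesgue) powr (1 / p)"
  unfolding grand_lebesgue_space_def function_space.simps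
  by (rule cSUP_least) (use p integrable_grand_term(2) in auto)

lemma fnorm_grand_lebesgue_space_nonneg: "0 \<le> fnorm (grand_lebesgue_space p a) f"
  unfolding grand_lebesgue_space_def function_space.simps
  by (rule cSUP_upper2[OF bdd_above_grand_term, of "p - 1"]) (use p grand_term_nonneg in auto)

text \<open>
  Continuity in \<open>\<epsilon>\<close> turns the supremum into one over a countable set, which makes the local norm
  measurable as a function of the position of the window.
\<close>

lemma continuous_on_grand_term: "continuous_on {0<..p - 1} (grand_term p a f)"
proof -
  have [measurable]: "a \<in> borel_measurable lebesgue" using a by auto
  have "continuous_on {0<..p - 1}
      (\<lambda>\<epsilon>. \<integral>x. norm (f x) powr (p - \<epsilon>) * a x powr (\<epsilon> / p) \<partial>lebesgue)"
    unfolding continuous_on_sequentially comp_def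
  proof safe
    fix e :: "nat \<Rightarrow> real" and \<epsilon>
    assume \<epsilon>: "\<epsilon> \<in> {0<..p - 1}" and e: "\<forall>n. e n \<in> {0<..p - 1}" and lim: "e \<longlonglongrightarrow> \<epsilon>"
    show "(\<lambda>n. \<integral>x. norm (f x) powr (p - e n) * a x powr (e n / p) \<partial>lebesgue)
      \<longlonglongrightarrow> (\<integral>x. norm (f x) powr (p - \<epsilon>) * a x powr (\<epsilon> / p) \<partial>lebesgue)"
    proof (rule integral_dominated_convergence)
      show "integrable lebesgue (\<lambda>x. norm (f x) powr p + a x)"
        using fp a by auto
      show "AE x in lebesgue. (\<lambda>n. norm (f x) powr (p - e n) * a x powr (e n / p))
          \<longlonglongrightarrow> norm (f x) powr (p - \<epsilon>) * a x powr (\<epsilon> / p)"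
      proof (rule AE_I2)
        fix x
        show "(\<lambda>n. norm (f x) powr (p - e n) * a x powr (e n / p))
          \<longlonglongrightarrow> norm (f x) powr (p - \<epsilon>) * a x powr (\<epsilon> / p)"
        \<comment> \<open>A zero base gives the constant sequence 0, since
          \<open>0 powr s = 0\<close> for every \<open>s\<close>; otherwise \<open>powr\<close> is
          continuous in the exponent.\<close>
        proof (cases "f x = 0 \<or> a x = 0")
          case False
          then show ?thesis using p by (intro tendsto_intros lim) auto
        qed auto
      qed
      show "AE x in lebesgue. norm (norm (f x) powr (p - e n) * a x powr (e n / p))
          \<le> norm (f x) powr p + a x" for n
      proof (rule AE_I2)
        fix x
        have en: "0 < e n" "e n \<le> p - 1" using e by auto
        define \<theta> where "\<theta> = (p - e n) / p"
        have \<theta>: "0 < \<theta>" "\<theta> < 1" "1 - \<theta> = e n / p" "p * \<theta> = p - e n"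
          using p en by (auto simp: \<theta>_def field_simps)
        have "norm (f x) powr (p - e n) * a x powr (e n / p) =
            (norm (f x) powr p) powr \<theta> * a x powr (1 - \<theta>)"
          by (simp add: powr_powr \<theta>(3,4))
        also have "\<dots> \<le> \<theta> * norm (f x) powr p + (1 - \<theta>) * a x"
          using \<theta>(1,2) a by (intro powr_mult_powr_le) auto
        also have "\<dots> \<le> norm (f x) powr p + a x"
          using \<theta>(1,2) a(2)[of x] by (intro add_mono mult_left_le_one_le) auto
        finally show "norm (norm (f x) powr (p - e n) * a x powr (e n / p))
          \<le> norm (f x) powr p + a x" by simp
      qed
    qed measurable
  qed
  then show ?thesis
    unfolding grand_term_def
    by (intro continuous_intros continuous_on_powr') (auto intro!: integral_nonneg_AE)
qed

text \<open>Rationals are dense in the open interval, and its closure restores the end point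
  \<open>p - 1\<close>, which may itself be irrational; continuity carries the bound over to the
  limit.\<close>

lemma fnorm_grand_lebesgue_space_eq_rat:
  "fnorm (grand_lebesgue_space p a) f = (SUP \<epsilon>\<in>{0<..<p - 1} \<inter> \<rat>. grand_term p a f \<epsilon>)"
proof -
  let ?I = "{0<..p - 1}" and ?D = "{0<..<p - 1} \<inter> \<rat>" and ?g = "grand_term p a f"
  have ne: "?D \<noteq> {}"
    using Rats_dense_in_real[of 0 "p - 1"] p by auto
  have bddD: "bdd_above (?g ` ?D)"
    by (rule bdd_above_mono[OF bdd_above_grand_term]) auto
  have "(SUP \<epsilon>\<in>?I. ?g \<epsilon>) \<le> (SUP \<epsilon>\<in>?D. ?g \<epsilon>)"
  proof (rule cSUP_least)
    fix \<epsilon> assume \<epsilon>: "\<epsilon> \<in> ?I"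
    have "closure ?D = closure {0<..<p - 1}"
      by (rule closure_open_Int_superset) (auto simp: Rats_closure_real)
    also have "\<dots> = {0..p - 1}"
      using p by simp
    finally have "\<epsilon> \<in> closure ?D" using \<epsilon> by auto
    then obtain e where e: "\<And>n. e n \<in> ?D" "e \<longlonglongrightarrow> \<epsilon>"
      unfolding closure_sequential by auto
    have "(\<lambda>n. ?g (e n)) \<longlonglongrightarrow> ?g \<epsilon>"
      using continuous_on_grand_term \<epsilon> e
      unfolding continuous_on_sequentially comp_def by (metis Int_iff greaterThanAtMost_iff greaterThanLessThan_iff less_imp_le)
    then show "?g \<epsilon> \<le> (SUP \<epsilon>\<in>?D. ?g \<epsilon>)"
      by (rule LIMSEQ_le_const2) (use e bddD in \<open>auto intro!: exI[of _ 0] cSUP_upper\<close>)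
  qed (use p in auto)
  moreover have "(SUP \<epsilon>\<in>?D. ?g \<epsilon>) \<le> (SUP \<epsilon>\<in>?I. ?g \<epsilon>)"
    using ne bdd_above_grand_term by (intro cSUP_subset_mono) auto
  ultimately show ?thesis
    by (simp add: grand_lebesgue_space_def)
qed

end

subsection \<open>Amalgam norms\<close>

lemma indicator_translate: "indicator ((+) x ` Q) y = indicator Q (y - x)"
  for x y :: "'a::ab_group_add"
  by (auto simp: indicator_def image_iff algebra_simps) (metis add.commute diff_add_cancel)

lemma borel_measurable_lborel_lebesgue: "f \<in> borel_measurable borel \<Longrightarrow> f \<in> borel_measurable lebesgue"
  by (rule measurable_completion) simp

text \<open>Changing \<open>w\<close> on a null set alters no window integral at all, so a Borel
  representative may replace it. Tonelli then weights each \<open>y\<close> by the measure of the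
  positions \<open>x\<close> whose window contains \<open>y\<close>, a reflected translate of
  \<open>Q\<close>.\<close>

lemma
  fixes w :: "'a::euclidean_space \<Rightarrow> ennreal"
  assumes w: "w \<in> borel_measurable lebesgue" and Q: "compact Q"
  shows borel_measurable_nn_integral_translate:
      "(\<lambda>x. \<integral>\<^sup>+y\<in>((+) x ` Q). w y \<partial>lebesgue) \<in> borel_measurable borel"
    and nn_integral_nn_integral_translate:
      "(\<integral>\<^sup>+x. (\<integral>\<^sup>+y\<in>((+) x ` Q). w y \<partial>lebesgue) \<partial>lebesgue) =
        emeasure lborel Q * (\<integral>\<^sup>+y. w y \<partial>lebesgue)"
proof -
  have [measurable]: "Q \<in> sets borel" using Q by (simp add: borel_compact)
  obtain w' where [measurable]: "w' \<in> borel_measurable borel" and eq: "AE y in lborel. w y = w' y"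
    using completion_ex_borel_measurable[OF w] by auto
  have inner: "(\<integral>\<^sup>+y\<in>((+) x ` Q). w y \<partial>lebesgue) = (\<integral>\<^sup>+y. w' y * indicator Q (y - x) \<partial>lborel)" for x
    unfolding nn_integral_completion indicator_translate
    by (rule nn_integral_cong_AE) (use eq in eventually_elim, simp)
  show "(\<lambda>x. \<integral>\<^sup>+y\<in>((+) x ` Q). w y \<partial>lebesgue) \<in> borel_measurable borel"
    unfolding inner by measurable
  have reflect: "(\<integral>\<^sup>+x. indicator Q (y - x) \<partial>lborel) = emeasure lborel Q" for y
  proof -
    have "emeasure lborel Q = (\<integral>\<^sup>+x. indicator Q x \<partial>lborel)" by simp
    \<comment> \<open>The substitution sending \<open>x\<close> to \<open>y - x\<close> preserves
      Lebesgue measure.\<close>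
    also have "\<dots> = (\<integral>\<^sup>+x. indicator Q (y - x) \<partial>lborel)"
      by (subst lborel_affine[of "-1" y]) (simp_all add: nn_integral_density nn_integral_distr density_1)
    finally show ?thesis by simp
  qed
  have "(\<integral>\<^sup>+x. (\<integral>\<^sup>+y\<in>((+) x ` Q). w y \<partial>lebesgue) \<partial>lebesgue) =
      (\<integral>\<^sup>+x. \<integral>\<^sup>+y. w' y * indicator Q (y - x) \<partial>lborel \<partial>lborel)"
    unfolding inner by (rule nn_integral_completion)
  also have "\<dots> = (\<integral>\<^sup>+y. \<integral>\<^sup>+x. w' y * indicator Q (y - x) \<partial>lborel \<partial>lborel)"
    by (rule lborel_pair.Fubini') measurable
  also have "\<dots> = (\<integral>\<^sup>+y. emeasure lborel Q * w' y \<partial>lborel)"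
    by (intro nn_integral_cong) (simp add: nn_integral_cmult reflect mult.commute)
  also have "\<dots> = emeasure lborel Q * (\<integral>\<^sup>+y. w y \<partial>lebesgue)"
    unfolding nn_integral_completion
  proof (subst nn_integral_cmult)
    have "(\<integral>\<^sup>+y. w' y \<partial>lborel) = (\<integral>\<^sup>+y. w y \<partial>lborel)"
      by (rule nn_integral_cong_AE) (use eq in eventually_elim, simp)
    then show "emeasure lborel Q * (\<integral>\<^sup>+y. w' y \<partial>lborel) = emeasure lborel Q * (\<integral>\<^sup>+y. w y \<partial>lborel)"
      by simp
  qed simp
  finally show "(\<integral>\<^sup>+x. (\<integral>\<^sup>+y\<in>((+) x ` Q). w y \<partial>lebesgue) \<partial>lebesgue) =
        emeasure lborel Q * (\<integral>\<^sup>+y. w y \<partial>lebesgue)" .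
qed

text \<open>Averages ignore null sets, so the two functions agree at every point and Borel
  measurability transfers without exceptions.\<close>

lemma hl_maximal_eq_maximal:
  assumes "AE y in lborel. norm (f y) = g y"
  shows "hl_maximal f = maximal (\<lambda>y. ennreal (g y))"
proof
  fix x
  have "(\<integral>\<^sup>+y\<in>ball x r. ennreal (norm (f y)) \<partial>lebesgue) = (\<integral>\<^sup>+y\<in>ball x r. ennreal (g y) \<partial>lborel)" for r
    unfolding nn_integral_completion
    by (rule nn_integral_cong_AE) (use assms in eventually_elim, simp)
  then show "hl_maximal f x = maximal (\<lambda>y. ennreal (g y)) x"
    unfolding hl_maximal_def maximal_def by simp
qed

lemma norm_restrict_to_powr: "norm (restrict_to K f x) powr s = norm (f x) powr s * indicator K x"
  by (simp add: restrict_to_def indicator_def)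

lemma borel_measurable_restrict_to [measurable]:
  "f \<in> borel_measurable M \<Longrightarrow> K \<in> sets M \<Longrightarrow> restrict_to K f \<in> borel_measurable M"
  unfolding restrict_to_def by (intro borel_measurable_times borel_measurable_indicator)

lemma sets_lebesgue_compact: "compact K \<Longrightarrow> K \<in> sets lebesgue"
  for K :: "'a::euclidean_space set"
  by (simp add: borel_compact)

lemma emeasure_lebesgue_compact_finite: "compact K \<Longrightarrow> emeasure lebesgue K < \<infinity>"
  for K :: "'a::euclidean_space set"
  using emeasure_compact_finite[of K] by (simp add: borel_compact)

lemma compact_translate: "compact Q \<Longrightarrow> compact ((+) x ` Q)"
  for Q :: "'a::euclidean_space set"
  by (rule compact_translation)

lemma measure_lebesgue_translate: "measure lebesgue ((+) x ` Q) = measure lebesgue Q"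
  for Q :: "'a::euclidean_space set"
  by (rule measure_translation)

text \<open>For a nonnegative measurable integrand the Bochner integral is \<open>enn2real\<close>
  of the nonnegative integral, also in the infinite case, where both are 0. This reduces the claim
  to window integrals.\<close>

lemma borel_measurable_grand_term_translate:
  fixes f :: "'a::euclidean_space \<Rightarrow> complex"
  assumes [measurable]: "f \<in> borel_measurable lebesgue" "a \<in> borel_measurable lebesgue"
    and Q: "compact Q"
  shows "(\<lambda>x. grand_term p a (restrict_to ((+) x ` Q) f) \<epsilon>) \<in> borel_measurable borel"
proof -
  let ?w = "\<lambda>y. norm (f y) powr (p - \<epsilon>) * a y powr (\<epsilon> / p)"
  have "(\<integral>y. norm (restrict_to ((+) x ` Q) f y) powr (p - \<epsilon>) * a y powr (\<epsilon> / p) \<partial>lebesgue) =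
      enn2real (\<integral>\<^sup>+y\<in>((+) x ` Q). ennreal (?w y) \<partial>lebesgue)" for x
  proof -
    have [measurable]: "(+) x ` Q \<in> sets lebesgue"
      by (intro sets_lebesgue_compact compact_translate Q)
    have [measurable]: "restrict_to ((+) x ` Q) f \<in> borel_measurable lebesgue"
      by measurable
    have "(\<integral>y. norm (restrict_to ((+) x ` Q) f y) powr (p - \<epsilon>) * a y powr (\<epsilon> / p) \<partial>lebesgue) =
        enn2real (\<integral>\<^sup>+y. ennreal (norm (restrict_to ((+) x ` Q) f y) powr (p - \<epsilon>) * a y powr (\<epsilon> / p)) \<partial>lebesgue)"
      by (rule integral_eq_nn_integral) simp_all
    also have "(\<integral>\<^sup>+y. ennreal (norm (restrict_to ((+) x ` Q) f y) powr (p - \<epsilon>) * a y powr (\<epsilon> / p)) \<partial>lebesgue)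
        = (\<integral>\<^sup>+y\<in>((+) x ` Q). ennreal (?w y) \<partial>lebesgue)"
      by (intro nn_integral_cong) (auto simp: norm_restrict_to_powr indicator_def)
    finally show ?thesis .
  qed
  moreover have [measurable]: "(\<lambda>x. \<integral>\<^sup>+y\<in>((+) x ` Q). ennreal (?w y) \<partial>lebesgue) \<in> borel_measurable borel"
    by (rule borel_measurable_nn_integral_translate[OF _ Q]) measurable
  ultimately show ?thesis
    unfolding grand_term_def by simp
qed

lemma integrable_restrict_to_powr:
  fixes f :: "'a::euclidean_space \<Rightarrow> complex"
  assumes f [measurable]: "f \<in> borel_measurable lebesgue" and K: "compact K" and st: "0 < s" "s \<le> t"
    and int: "integrable lebesgue (\<lambda>y. norm (restrict_to K f y) powr t)"
  shows "integrable lebesgue (\<lambda>y. norm (restrict_to K f y) powr s)"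
    and "(\<integral>y. norm (restrict_to K f y) powr s \<partial>lebesgue) \<le>
      (1 + measure lebesgue K) * (\<integral>y. norm (restrict_to K f y) powr t \<partial>lebesgue) powr (s / t)"
proof -
  have [measurable]: "K \<in> sets lebesgue" by (rule sets_lebesgue_compact[OF K])
  have m: "(\<lambda>y. norm (restrict_to K f y)) \<in> borel_measurable lebesgue" by measurable
  note * = powr_norm_mono_finite_support[OF m, of K s t]
  show "integrable lebesgue (\<lambda>y. norm (restrict_to K f y) powr s)"
    by (rule *(1)) (use emeasure_lebesgue_compact_finite[OF K] st int in \<open>auto simp: restrict_to_def\<close>)
  show "(\<integral>y. norm (restrict_to K f y) powr s \<partial>lebesgue) \<le>
      (1 + measure lebesgue K) * (\<integral>y. norm (restrict_to K f y) powr t \<partial>lebesgue) powr (s / t)"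
    by (rule *(2)) (use emeasure_lebesgue_compact_finite[OF K] st int in \<open>auto simp: restrict_to_def\<close>)
qed

lemma nn_integral_restrict_to_powr:
  "(\<integral>\<^sup>+y. ennreal (norm (restrict_to K f y) powr s) \<partial>M) = (\<integral>\<^sup>+y\<in>K. ennreal (norm (f y) powr s) \<partial>M)"
  by (intro nn_integral_cong) (auto simp: norm_restrict_to_powr indicator_def)

text \<open>On each window the exponent drops from \<open>r\<close> to \<open>q\<close> at a cost
  that translation invariance makes the same everywhere; integrating over all windows counts
  \<open>f\<close> with weight the measure of \<open>Q\<close>. The left side is extended real
  because finiteness is part of what is gained.\<close>

lemma nn_integral_powr_le_wiener_amalgam:
  fixes f :: "'a::euclidean_space \<Rightarrow> complex"
  assumes Q: "compact Q" and qr: "0 < q" "q \<le> r"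
    and f: "f \<in> members (wiener_amalgam Q (lebesgue_space r) (lebesgue_space q))"
  shows "emeasure lebesgue Q * (\<integral>\<^sup>+y. ennreal (norm (f y) powr q) \<partial>lebesgue) \<le>
    ennreal ((1 + measure lebesgue Q) *
      fnorm (wiener_amalgam Q (lebesgue_space r) (lebesgue_space q)) f powr q)"
proof -
  define L where "L x = (\<integral>y. norm (restrict_to ((+) x ` Q) f y) powr r \<partial>lebesgue) powr (1 / r)" for x
  have [measurable]: "f \<in> borel_measurable lebesgue"
    and loc: "integrable lebesgue (\<lambda>y. norm (restrict_to ((+) x ` Q) f y) powr r)"
    and glob: "integrable lebesgue (\<lambda>x. L x powr q)" for x
    using f compact_translate[OF Q, of x]
    by (auto simp: wiener_amalgam_def lebesgue_space_def local_norm_def L_def)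
  have norm: "fnorm (wiener_amalgam Q (lebesgue_space r) (lebesgue_space q)) f =
      (\<integral>x. L x powr q \<partial>lebesgue) powr (1 / q)"
    by (simp add: wiener_amalgam_def lebesgue_space_def local_norm_def L_def)
  have "emeasure lebesgue Q * (\<integral>\<^sup>+y. ennreal (norm (f y) powr q) \<partial>lebesgue) =
      (\<integral>\<^sup>+x. (\<integral>\<^sup>+y\<in>((+) x ` Q). ennreal (norm (f y) powr q) \<partial>lebesgue) \<partial>lebesgue)"
    using Q by (subst nn_integral_nn_integral_translate) (auto simp: borel_compact)
  also have "\<dots> \<le> (\<integral>\<^sup>+x. ennreal ((1 + measure lebesgue Q) * L x powr q) \<partial>lebesgue)"
  proof (rule nn_integral_mono)
    fix x
    note * = integrable_restrict_to_powr[OF _ compact_translate[OF Q] qr loc, of x]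
    have "(\<integral>\<^sup>+y\<in>((+) x ` Q). ennreal (norm (f y) powr q) \<partial>lebesgue) =
        ennreal (\<integral>y. norm (restrict_to ((+) x ` Q) f y) powr q \<partial>lebesgue)"
      unfolding nn_integral_restrict_to_powr[symmetric]
      by (rule nn_integral_eq_integral) (use * in auto)
    also have "\<dots> \<le> ennreal ((1 + measure lebesgue Q) * L x powr q)"
      using *(2) qr by (intro ennreal_leI) (simp add: measure_lebesgue_translate L_def powr_powr)
    finally show "(\<integral>\<^sup>+y\<in>((+) x ` Q). ennreal (norm (f y) powr q) \<partial>lebesgue) \<le>
        ennreal ((1 + measure lebesgue Q) * L x powr q)" .
  qed
  also have "\<dots> = ennreal (\<integral>x. (1 + measure lebesgue Q) * L x powr q \<partial>lebesgue)"
    by (rule nn_integral_eq_integral) (use glob in auto)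
  also have "\<dots> = ennreal ((1 + measure lebesgue Q) *
      fnorm (wiener_amalgam Q (lebesgue_space r) (lebesgue_space q)) f powr q)"
    using qr by (simp add: norm powr_powr)
  finally show ?thesis .
qed

text \<open>\<open>A\<close> and \<open>B\<close> are the costs of the inner and outer embeddings
  into grand spaces, \<open>(1 + measure lebesgue Q) powr (q / p)\<close> that of lowering
  \<open>q\<close> to \<open>p\<close> on a window, and the bare measure of \<open>Q\<close> comes
  from Tonelli.\<close>

lemma
  fixes F :: "'a::euclidean_space \<Rightarrow> complex" and a b :: "'a \<Rightarrow> real"
  assumes Q: "compact Q" and pq: "1 < p" "p \<le> q"
    and a: "integrable lebesgue a" "\<And>x. 0 \<le> a x" and b: "integrable lebesgue b" "\<And>x. 0 \<le> b x"
    and F [measurable]: "F \<in> borel_measurable lebesgue"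
    and Fq: "integrable lebesgue (\<lambda>y. norm (F y) powr q)"
  defines "A \<equiv> (p - 1) * (1 + (\<integral>x. a x \<partial>lebesgue))" and "B \<equiv> (q - 1) * (1 + (\<integral>x. b x \<partial>lebesgue))"
  shows members_wiener_amalgam_grand:
      "F \<in> members (wiener_amalgam Q (grand_lebesgue_space p a) (grand_lebesgue_space q b))"
    and fnorm_wiener_amalgam_grand_le:
      "fnorm (wiener_amalgam Q (grand_lebesgue_space p a) (grand_lebesgue_space q b)) F \<le>
        B * (A powr q * (1 + measure lebesgue Q) powr (q / p) * measure lebesgue Q *
          (\<integral>y. norm (F y) powr q \<partial>lebesgue)) powr (1 / q)"
proof -
  let ?m = "measure lebesgue Q" and ?G = "grand_lebesgue_space p a"
  have [measurable]: "a \<in> borel_measurable lebesgue" using a by auto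
  have q: "1 < q" "0 < p" using pq by auto
  have A: "0 \<le> A" and B: "0 \<le> B" using pq a b by (auto simp: A_def B_def)
  have rest [measurable]: "restrict_to K F \<in> borel_measurable lebesgue" if "compact K" for K
    using sets_lebesgue_compact[OF that] by measurable
  have intq: "integrable lebesgue (\<lambda>y. norm (restrict_to K F y) powr q)" if "compact K" for K
    unfolding norm_restrict_to_powr
    by (rule integrable_real_mult_indicator) (use that Fq sets_lebesgue_compact in auto)
  have intp: "integrable lebesgue (\<lambda>y. norm (restrict_to K F y) powr p)" if "compact K" for K
    by (rule integrable_restrict_to_powr(1)[OF F that q(2) pq(2) intq[OF that]])
  note cQ = compact_translate[OF Q]
  define N where "N x = fnorm ?G (restrict_to ((+) x ` Q) F)" for x
  have local_N: "local_norm Q ?G F = (\<lambda>x. complex_of_real (N x))"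
    by (simp add: local_norm_def N_def)
  have N0: "0 \<le> N x" for x
    unfolding N_def by (rule fnorm_grand_lebesgue_space_nonneg[OF pq(1) a rest[OF cQ] intp[OF cQ]])
  have N_eq: "N x = (SUP \<epsilon>\<in>{0<..<p - 1} \<inter> \<rat>. grand_term p a (restrict_to ((+) x ` Q) F) \<epsilon>)" for x
    unfolding N_def by (rule fnorm_grand_lebesgue_space_eq_rat[OF pq(1) a rest[OF cQ] intp[OF cQ]])
  \<comment> \<open>The supremum over rational \<open>\<epsilon>\<close> is countable, hence
    measurable termwise.\<close>
  have "N \<in> borel_measurable borel"
    unfolding N_eq[abs_def]
  proof (rule borel_measurable_cSUP)
    show "countable ({0<..<p - 1} \<inter> \<rat>)"
      by (intro countable_Int2 countable_rat)
    show "(\<lambda>x. grand_term p a (restrict_to ((+) x ` Q) F) \<epsilon>) \<in> borel_measurable borel" for \<epsilon>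
      by (rule borel_measurable_grand_term_translate) (use Q in auto)
    show "bdd_above (grand_term p a (restrict_to ((+) x ` Q) F) ` ({0<..<p - 1} \<inter> \<rat>))" for x
      by (rule bdd_above_mono[OF bdd_above_grand_term[OF pq(1) a rest[OF cQ] intp[OF cQ]]]) auto
  qed
  then have N [measurable]: "N \<in> borel_measurable lebesgue"
    by (rule borel_measurable_lborel_lebesgue)
  let ?K = "A powr q * (1 + ?m) powr (q / p)"
  have Nq: "ennreal (N x powr q) \<le>
      ennreal ?K * (\<integral>\<^sup>+y\<in>((+) x ` Q). ennreal (norm (F y) powr q) \<partial>lebesgue)" for x
  proof -
    let ?h = "\<lambda>s. \<integral>y. norm (restrict_to ((+) x ` Q) F y) powr s \<partial>lebesgue"
    have "N x \<le> A * ?h p powr (1 / p)"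
      unfolding N_def A_def by (rule fnorm_grand_lebesgue_space_le[OF pq(1) a rest[OF cQ] intp[OF cQ]])
    also have "?h p powr (1 / p) \<le> ((1 + ?m) * ?h q powr (p / q)) powr (1 / p)"
      using integrable_restrict_to_powr(2)[OF F cQ q(2) pq(2) intq[OF cQ], of x] pq
      by (intro powr_mono2) (auto simp: measure_lebesgue_translate)
    finally have "N x powr q \<le> (A * ((1 + ?m) * ?h q powr (p / q)) powr (1 / p)) powr q"
      using A N0 q by (intro powr_mono2) (auto simp: mult_left_mono)
    also have "\<dots> = ?K * ?h q"
      using A q by (simp add: powr_mult powr_powr)
    finally have "ennreal (N x powr q) \<le> ennreal ?K * ennreal (?h q)"
      by (simp add: ennreal_leI flip: ennreal_mult)
    also have "ennreal (?h q) = (\<integral>\<^sup>+y\<in>((+) x ` Q). ennreal (norm (F y) powr q) \<partial>lebesgue)"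
      unfolding nn_integral_restrict_to_powr[symmetric]
      by (rule nn_integral_eq_integral[symmetric]) (use intq[OF cQ] in auto)
    finally show ?thesis .
  qed
  have [measurable]: "(\<lambda>x. \<integral>\<^sup>+y\<in>((+) x ` Q). ennreal (norm (F y) powr q) \<partial>lebesgue) \<in> borel_measurable lebesgue"
    by (rule borel_measurable_lborel_lebesgue, rule borel_measurable_nn_integral_translate[OF _ Q])
      measurable
  have mQ: "emeasure lborel Q = ennreal ?m"
    using emeasure_lebesgue_compact_finite[OF Q] Q
    by (simp add: emeasure_eq_ennreal_measure borel_compact less_top)
  have "(\<integral>\<^sup>+x. ennreal (N x powr q) \<partial>lebesgue) \<le>
      (\<integral>\<^sup>+x. ennreal ?K * (\<integral>\<^sup>+y\<in>((+) x ` Q). ennreal (norm (F y) powr q) \<partial>lebesgue) \<partial>lebesgue)"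
    by (intro nn_integral_mono Nq)
  also have "\<dots> = ennreal ?K * (emeasure lborel Q * (\<integral>\<^sup>+y. ennreal (norm (F y) powr q) \<partial>lebesgue))"
    by (subst nn_integral_cmult, measurable, subst nn_integral_nn_integral_translate[OF _ Q]) simp_all
  also have "(\<integral>\<^sup>+y. ennreal (norm (F y) powr q) \<partial>lebesgue) = ennreal (\<integral>y. norm (F y) powr q \<partial>lebesgue)"
    by (rule nn_integral_eq_integral) (use Fq in auto)
  also have "ennreal ?K * (emeasure lborel Q * ennreal (\<integral>y. norm (F y) powr q \<partial>lebesgue)) =
      ennreal (?K * ?m * (\<integral>y. norm (F y) powr q \<partial>lebesgue))"
    unfolding mQ by (simp add: ennreal_mult mult.assoc)
  finally have le: "(\<integral>\<^sup>+x. ennreal (N x powr q) \<partial>lebesgue) \<le>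
      ennreal (?K * ?m * (\<integral>y. norm (F y) powr q \<partial>lebesgue))" .
  then have int: "integrable lebesgue (\<lambda>x. N x powr q)"
    by (intro integrableI_bounded) (auto intro: le_less_trans)
  then have "ennreal (\<integral>x. N x powr q \<partial>lebesgue) = (\<integral>\<^sup>+x. ennreal (N x powr q) \<partial>lebesgue)"
    by (intro nn_integral_eq_integral[symmetric]) auto
  with le have "ennreal (\<integral>x. N x powr q \<partial>lebesgue) \<le>
      ennreal (?K * ?m * (\<integral>y. norm (F y) powr q \<partial>lebesgue))"
    by (simp only:)
  then have "(\<integral>x. N x powr q \<partial>lebesgue) \<le> ?K * ?m * (\<integral>y. norm (F y) powr q \<partial>lebesgue)"
    by (subst (asm) ennreal_le_iff) auto
  then have "(\<integral>x. N x powr q \<partial>lebesgue) powr (1 / q) \<le>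
      (?K * ?m * (\<integral>y. norm (F y) powr q \<partial>lebesgue)) powr (1 / q)"
    using q by (intro powr_mono2) auto
  moreover
  have Nc: "(\<lambda>x. complex_of_real (N x)) \<in> borel_measurable lebesgue"
    "integrable lebesgue (\<lambda>x. norm (complex_of_real (N x)) powr q)"
    using int N0 by auto
  have "fnorm (grand_lebesgue_space q b) (\<lambda>x. complex_of_real (N x)) \<le>
      B * (\<integral>x. N x powr q \<partial>lebesgue) powr (1 / q)"
    using fnorm_grand_lebesgue_space_le[OF q(1) b Nc] N0 by (simp add: B_def)
  ultimately show "fnorm (wiener_amalgam Q ?G (grand_lebesgue_space q b)) F \<le>
      B * (?K * ?m * (\<integral>y. norm (F y) powr q \<partial>lebesgue)) powr (1 / q)"
    using mult_left_mono[OF _ B] by (fastforce simp: wiener_amalgam_def local_N intro: order_trans)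
  show "F \<in> members (wiener_amalgam Q ?G (grand_lebesgue_space q b))"
    using members_grand_lebesgue_space[OF q(1) b Nc]
      members_grand_lebesgue_space[OF pq(1) a rest intp]
    by (auto simp: wiener_amalgam_def local_N)
qed

lemma
  fixes f :: "'a::euclidean_space \<Rightarrow> complex"
  assumes f: "f \<in> borel_measurable lebesgue" and q: "1 < q"
    and fin: "(\<integral>\<^sup>+y. ennreal (norm (f y) powr q) \<partial>lebesgue) < \<infinity>"
  shows AE_hl_maximal_finite: "AE x in lebesgue. hl_maximal f x < \<infinity>"
    and borel_measurable_hl_maximal: "finite_part (hl_maximal f) \<in> borel_measurable lebesgue"
    and nn_integral_hl_maximal_le:
      "(\<integral>\<^sup>+x. ennreal (norm (finite_part (hl_maximal f) x) powr q) \<partial>lebesgue) \<le>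
        ennreal (maximal_const TYPE('a) q) * (\<integral>\<^sup>+y. ennreal (norm (f y) powr q) \<partial>lebesgue)"
proof -
  have "(\<lambda>y. norm (f y)) \<in> borel_measurable lebesgue" using f by measurable
  then obtain g' where [measurable]: "g' \<in> borel_measurable lborel" and g': "AE y in lborel. norm (f y) = g' y"
    by (rule completion_ex_borel_measurable_real[THEN bexE])
  \<comment> \<open>The representative equals a norm only almost everywhere, while the strong type
    theorem asks for nonnegativity at every point.\<close>
  define g where "g y = max 0 (g' y)" for y
  have [measurable]: "g \<in> borel_measurable borel" and g0: "0 \<le> g y" for y
    unfolding g_def by auto
  have g: "AE y in lborel. norm (f y) = g y"
    using g' by eventually_elim (metis g_def max.absorb2 norm_ge_zero)
  note M = hl_maximal_eq_maximal[OF g]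
  have eq: "(\<integral>\<^sup>+y. ennreal (g y powr q) \<partial>lborel) = (\<integral>\<^sup>+y. ennreal (norm (f y) powr q) \<partial>lebesgue)"
    unfolding nn_integral_completion by (rule nn_integral_cong_AE) (use g in eventually_elim, simp)
  note strong = maximal_strong_type[OF \<open>g \<in> borel_measurable borel\<close> g0 q, unfolded eq, OF fin]
  show "AE x in lebesgue. hl_maximal f x < \<infinity>"
    unfolding M using strong(1) by (rule AE_completion)
  have "finite_part (hl_maximal f) \<in> borel_measurable borel"
    unfolding M finite_part_def by measurable
  then show "finite_part (hl_maximal f) \<in> borel_measurable lebesgue"
    by (rule borel_measurable_lborel_lebesgue)
  show "(\<integral>\<^sup>+x. ennreal (norm (finite_part (hl_maximal f) x) powr q) \<partial>lebesgue) \<le>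
        ennreal (maximal_const TYPE('a) q) * (\<integral>\<^sup>+y. ennreal (norm (f y) powr q) \<partial>lebesgue)"
    using strong(2) unfolding M finite_part_def nn_integral_completion by simp
qed

section \<open>Boundedness between the amalgam spaces\<close>

theorem proposition4p1:
  fixes p q r :: real
    and a b :: "real ^ 'n \<Rightarrow> real"
    and Q :: "(real ^ 'n) set"
  assumes "1 < p" and "p \<le> q" and "q \<le> r"
    and "weight a" and "weight b"
    and "integrable lebesgue a" and "integrable lebesgue b"
    and "compact Q" and "interior Q \<noteq> {}"
  shows "bounded_operator hl_maximal
    (wiener_amalgam Q (lebesgue_space r) (lebesgue_space q))
    (wiener_amalgam Q (grand_lebesgue_space p a) (grand_lebesgue_space q b))"
proof -
  let ?X = "wiener_amalgam Q (lebesgue_space r) (lebesgue_space q)"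
  let ?Y = "wiener_amalgam Q (grand_lebesgue_space p a) (grand_lebesgue_space q b)"
  let ?m = "measure lebesgue Q"
  note Q = \<open>compact Q\<close>
  have q: "1 < q" "0 < q" using assms by auto
  have a0: "\<And>x. 0 \<le> a x" and b0: "\<And>x. 0 \<le> b x"
    using assms by (auto simp: weight_def)
  define A B S where "A = (p - 1) * (1 + (\<integral>x. a x \<partial>lebesgue))"
    and "B = (q - 1) * (1 + (\<integral>x. b x \<partial>lebesgue))" and "S = maximal_const TYPE(real ^ 'n) q"
  have "0 \<le> (\<integral>x. a x \<partial>lebesgue)" "0 \<le> (\<integral>x. b x \<partial>lebesgue)" using a0 b0 by simp_all
  then have A: "0 < A" and B: "0 < B"
    using assms by (auto simp: A_def B_def intro!: mult_pos_pos)
  have S: "0 < S" using q by (simp add: S_def maximal_const_def)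
  have eQ: "emeasure lebesgue Q = ennreal ?m"
    using emeasure_lebesgue_compact_finite[OF Q] by (simp add: emeasure_eq_ennreal_measure less_top)
  have m: "0 < ?m"
  proof -
    obtain x e where "0 < e" "ball x e \<subseteq> Q"
      using \<open>interior Q \<noteq> {}\<close> by (auto simp: mem_interior)
    then have "0 < emeasure lebesgue (ball x e)" "emeasure lebesgue (ball x e) \<le> emeasure lebesgue Q"
      using emeasure_mono[OF \<open>ball x e \<subseteq> Q\<close> sets_lebesgue_compact[OF Q]]
      by (simp_all add: emeasure_ball_pos)
    then show ?thesis unfolding eQ by (metis ennreal_less_zero_iff order_less_le_trans)
  qed
  \<comment> \<open>The powers of \<open>A\<close> and of \<open>1 + ?m\<close> before
    \<open>S\<close> come from the target embedding, \<open>S\<close> from the maximal theorem, and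
    the last \<open>1 + ?m\<close> from the source embedding.\<close>
  define D where "D = A powr q * (1 + ?m) powr (q / p) * S * (1 + ?m)"
  have D: "0 < D" using A S m by (auto simp: D_def)
  define C where "C = B * D powr (1 / q)"
  show ?thesis
    unfolding bounded_operator_def
  proof (intro exI conjI ballI)
    show "0 < C" using B D by (simp add: C_def)
    fix f assume f: "f \<in> members ?X"
    define I where "I = (\<integral>\<^sup>+y. ennreal (norm (f y) powr q) \<partial>lebesgue)"
    have fm: "f \<in> borel_measurable lebesgue"
      using f by (simp add: wiener_amalgam_def)
    have fX: "0 \<le> fnorm ?X f"
      by (simp add: wiener_amalgam_def lebesgue_space_def)
    have le: "ennreal ?m * I \<le> ennreal ((1 + ?m) * fnorm ?X f powr q)"
      using nn_integral_powr_le_wiener_amalgam[OF Q q(2) \<open>q \<le> r\<close> f] by (simp add: I_def eQ)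
    \<comment> \<open>Positivity of \<open>?m\<close> matters here: it would make the left side of
      \<open>le\<close> infinite along with \<open>I\<close>.\<close>
    have "I \<noteq> \<infinity>" using le m by (auto simp: ennreal_mult_top top_unique)
    then obtain J where J: "0 \<le> J" "I = ennreal J" by (cases I) auto
    have mJ: "?m * J \<le> (1 + ?m) * fnorm ?X f powr q"
      using le J m by (simp add: ennreal_le_iff flip: ennreal_mult)
    let ?F = "finite_part (hl_maximal f)"
    have fin: "(\<integral>\<^sup>+y. ennreal (norm (f y) powr q) \<partial>lebesgue) < \<infinity>"
      using J by (simp add: I_def[symmetric])
    show "AE x in lebesgue. hl_maximal f x < \<infinity>"
      by (rule AE_hl_maximal_finite[OF fm q(1) fin])
    have F [measurable]: "?F \<in> borel_measurable lebesgue"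
      by (rule borel_measurable_hl_maximal[OF fm q(1) fin])
    have F_le: "(\<integral>\<^sup>+x. ennreal (norm (?F x) powr q) \<partial>lebesgue) \<le> ennreal (S * J)"
      using nn_integral_hl_maximal_le[OF fm q(1) fin] J S
      by (simp add: I_def[symmetric] S_def[symmetric] ennreal_mult)
    then have Fq: "integrable lebesgue (\<lambda>x. norm (?F x) powr q)"
      by (intro integrableI_bounded) (auto intro: le_less_trans)
    then have "ennreal (\<integral>x. norm (?F x) powr q \<partial>lebesgue) \<le> ennreal (S * J)"
      using F_le by (subst (asm) nn_integral_eq_integral) auto
    then have FJ: "(\<integral>x. norm (?F x) powr q \<partial>lebesgue) \<le> S * J"
      using S J by (simp add: ennreal_le_iff)
    note Y = Q \<open>1 < p\<close> \<open>p \<le> q\<close> \<open>integrable lebesgue a\<close> a0 \<open>integrable lebesgue b\<close> b0 F Fq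
    show "?F \<in> members ?Y"
      by (rule members_wiener_amalgam_grand[OF Y])
    have "A powr q * (1 + ?m) powr (q / p) * ?m * (\<integral>x. norm (?F x) powr q \<partial>lebesgue) \<le>
        A powr q * (1 + ?m) powr (q / p) * ?m * (S * J)"
      using FJ by (intro mult_left_mono) auto
    \<comment> \<open>The factor \<open>?m\<close> from Tonelli in the target joins \<open>J\<close>
      to form the left side of \<open>mJ\<close>, so no division by the measure of \<open>Q\<close>
      occurs.\<close>
    also have "\<dots> = A powr q * (1 + ?m) powr (q / p) * S * (?m * J)"
      by (simp add: ac_simps)
    also have "\<dots> \<le> A powr q * (1 + ?m) powr (q / p) * S * ((1 + ?m) * fnorm ?X f powr q)"
      using mJ S by (intro mult_left_mono) auto
    also have "\<dots> = D * fnorm ?X f powr q"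
      by (simp add: D_def)
    finally have "(A powr q * (1 + ?m) powr (q / p) * ?m * (\<integral>x. norm (?F x) powr q \<partial>lebesgue)) powr (1 / q)
        \<le> (D * fnorm ?X f powr q) powr (1 / q)"
      using q by (intro powr_mono2) auto
    also have "\<dots> = D powr (1 / q) * fnorm ?X f"
      using D q fX by (simp add: powr_mult powr_powr)
    finally have "B * (A powr q * (1 + ?m) powr (q / p) * ?m * (\<integral>x. norm (?F x) powr q \<partial>lebesgue)) powr (1 / q)
        \<le> C * fnorm ?X f"
      using B by (simp add: C_def)
    then show "fnorm ?Y ?F \<le> C * fnorm ?X f"
      using fnorm_wiener_amalgam_grand_le[OF Y] by (simp add: A_def B_def)
  qed
qed

end
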